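(* Let $\pi$ be a strictly positive probability distribution on $\{1,\dots,I_1\}\times\{1,\dots,I_2\}$, $I_1,I_2\ge2$, and let $l_1,l_2\in\{L,G,C,R\}$ be the row and column logit types, at least one of which is $G$. If all $F$-scaled interactions satisfy $\gamma_{ij}(F;l_1,l_2)\ge0$ for $i<I_1$, $j<I_2$, then all log-odds ratios of the same type are non negative: $\eta_{1,2;l_1,l_2}(i,j)\ge0$ for all $i<I_1$, $j<I_2$.
   Context: $(X_1,X_2)$ has joint distribution $\pi=(\pi_{ij})$, $X_1$ with categories $1,\dots,I_1$ and $X_2$ with categories $1,\dots,I_2$. Each variable is assigned a logit type $l\in\{L,G,C,R\}$ (local, global, continuation, reverse continuation). For a variable with $I$ categories and a cut point $x\in\{1,\dots,I-1\}$ define $E(x,0,l)=\{x\}$ if $l\in\{L,C\}$ and $E(x,0,l)=\{1,\dots,x\}$ if $l\in\{G,R\}$; $E(x,1,l)=\{x+1\}$ if $l\in\{L,R\}$ and $E(x,1,l)=\{x+1,\dots,I\}$ if $l\in\{G,C\}$. Put $p(i,j;u,v)=P(X_1\in E(i,u,l_1),X_2\in E(j,v,l_2))$, $p_1(i;u)=P(X_1\in E(i,u,l_1))$, $p_2(j;v)=P(X_2\in E(j,v,l_2))$ for $i<I_1$, $j<I_2$, $u,v\in\{0,1\}$. Log-odds ratios (LORs) of type $l_1l_2$: $\eta_{1,2;l_1,l_2}(i,j)=\log p(i,j;1,1)-\log p(i,j;0,1)-\log p(i,j;1,0)+\log p(i,j;0,0)$. $\phi$ is a real-valued convex function on $[0,\infty)$,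 differentiable on $(0,\infty)$, with $\phi(1)=\phi'(1)=0$, and $F=\phi'$ is strictly increasing on $(0,\infty)$ (so it has an inverse). With $\varrho_{ij}(u,v)=\dfrac{p(i,j;u,v)}{p_1(i;u)\,p_2(j;v)}$, the $F$-scaled interactions of type $l_1l_2$ are $$\gamma_{ij}(F;l_1,l_2)=F[\varrho_{ij}(1,1)]-F[\varrho_{ij}(1,0)]-F[\varrho_{ij}(0,1)]+F[\varrho_{ij}(0,0)].$$ *)

theory Defs
  imports "HOL-Probability.Probability_Mass_Function"
begin

datatype logit_type = Local | Global | Continuation | Reverse_Continuation

text \<open>For a variable with categories \<open>{1..I}\<close>, a cut point \<open>1 \<le> x < I\<close> and \<open>u \<in> {0, 1}\<close>:
  the category sets compared by a logit. Only \<open>u = 0\<close> and \<open>u = 1\<close> are meaningful.\<close>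

definition logit_set :: "nat \<Rightarrow> nat \<Rightarrow> nat \<Rightarrow> logit_type \<Rightarrow> nat set" where
  "logit_set I x u l =
    (if u = 0
     then (if l \<in> {Local, Continuation} then {x} else {1..x})
     else (if l \<in> {Local, Reverse_Continuation} then {x + 1} else {x + 1..I}))"

text \<open>The joint distribution of \<open>(X\<^sub>1, X\<^sub>2)\<close> is a pmf on pairs, so that \<open>X\<^sub>1 = fst\<close> and
  \<open>X\<^sub>2 = snd\<close>.\<close>

definition joint_prob ::
  "(nat \<times> nat) pmf \<Rightarrow> nat \<Rightarrow> nat \<Rightarrow> logit_type \<Rightarrow> logit_type \<Rightarrow> nat \<Rightarrow> nat \<Rightarrow> nat \<Rightarrow> nat \<Rightarrow> real" where
  "joint_prob \<pi> I\<^sub>1 I\<^sub>2 l\<^sub>1 l\<^sub>2 i j u v =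
    measure_pmf.prob \<pi> {\<omega>. fst \<omega> \<in> logit_set I\<^sub>1 i u l\<^sub>1 \<and> snd \<omega> \<in> logit_set I\<^sub>2 j v l\<^sub>2}"

definition row_prob ::
  "(nat \<times> nat) pmf \<Rightarrow> nat \<Rightarrow> logit_type \<Rightarrow> nat \<Rightarrow> nat \<Rightarrow> real" where
  "row_prob \<pi> I\<^sub>1 l\<^sub>1 i u = measure_pmf.prob \<pi> {\<omega>. fst \<omega> \<in> logit_set I\<^sub>1 i u l\<^sub>1}"

definition col_prob ::
  "(nat \<times> nat) pmf \<Rightarrow> nat \<Rightarrow> logit_type \<Rightarrow> nat \<Rightarrow> nat \<Rightarrow> real" where
  "col_prob \<pi> I\<^sub>2 l\<^sub>2 j v = measure_pmf.prob \<pi> {\<omega>. snd \<omega> \<in> logit_set I\<^sub>2 j v l\<^sub>2}"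

definition log_odds_ratio ::
  "(nat \<times> nat) pmf \<Rightarrow> nat \<Rightarrow> nat \<Rightarrow> logit_type \<Rightarrow> logit_type \<Rightarrow> nat \<Rightarrow> nat \<Rightarrow> real" where
  "log_odds_ratio \<pi> I\<^sub>1 I\<^sub>2 l\<^sub>1 l\<^sub>2 i j =
    (let p = joint_prob \<pi> I\<^sub>1 I\<^sub>2 l\<^sub>1 l\<^sub>2 i j
     in ln (p 1 1) - ln (p 0 1) - ln (p 1 0) + ln (p 0 0))"

definition dependence_ratio ::
  "(nat \<times> nat) pmf \<Rightarrow> nat \<Rightarrow> nat \<Rightarrow> logit_type \<Rightarrow> logit_type \<Rightarrow> nat \<Rightarrow> nat \<Rightarrow> nat \<Rightarrow> nat \<Rightarrow> real" where
  "dependence_ratio \<pi> I\<^sub>1 I\<^sub>2 l\<^sub>1 l\<^sub>2 i j u v =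
    joint_prob \<pi> I\<^sub>1 I\<^sub>2 l\<^sub>1 l\<^sub>2 i j u v / (row_prob \<pi> I\<^sub>1 l\<^sub>1 i u * col_prob \<pi> I\<^sub>2 l\<^sub>2 j v)"

definition scaled_interaction ::
  "(real \<Rightarrow> real) \<Rightarrow> (nat \<times> nat) pmf \<Rightarrow> nat \<Rightarrow> nat \<Rightarrow> logit_type \<Rightarrow> logit_type
    \<Rightarrow> nat \<Rightarrow> nat \<Rightarrow> real" where
  "scaled_interaction F \<pi> I\<^sub>1 I\<^sub>2 l\<^sub>1 l\<^sub>2 i j =
    (let \<rho> = dependence_ratio \<pi> I\<^sub>1 I\<^sub>2 l\<^sub>1 l\<^sub>2 i j
     in F (\<rho> 1 1) - F (\<rho> 1 0) - F (\<rho> 0 1) + F (\<rho> 0 0))"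

end

theory Submission
  imports Defs
begin

text \<open>If the row logit is global, the two row sets partition the categories, so
  \<open>p(0,v) + p(1,v) = p\<^sub>2(v)\<close>. Hence, up to positive factors depending only on \<open>u\<close>,
  \<open>\<rho>(u,v)\<close> is the conditional probability of row set \<open>u\<close> given column set \<open>v\<close>, and
  \<open>p(1,1) p(0,0) < p(1,0) p(0,1)\<close> forces both \<open>\<rho>(1,1) < \<rho>(1,0)\<close> and \<open>\<rho>(0,0) < \<rho>(0,1)\<close>;
  monotonicity of \<open>F\<close> then makes the interaction at the same cut point negative.\<close>

text \<open>Stated for bare reals so that both cases, row logit global and column logit global, can
  use it. \<open>a0\<close> and \<open>a1\<close> stand for the marginals of the global variable;
  the sums \<open>p00 + p10\<close> and \<open>p01 + p11\<close> are the marginals of the other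
  one.\<close>

lemma odds_ratio_ge_of_scaled_interaction:
  fixes F :: "real \<Rightarrow> real"
  assumes F: "strict_mono_on {0<..} F"
    and pos: "p00 > 0" "p01 > 0" "p10 > 0" "p11 > 0" "a0 > 0" "a1 > 0"
    and interaction: "F (p11 / (a1 * (p01 + p11))) - F (p10 / (a1 * (p00 + p10)))
      - F (p01 / (a0 * (p01 + p11))) + F (p00 / (a0 * (p00 + p10))) \<ge> 0"
  shows "p01 * p10 \<le> p00 * p11"
proof (rule ccontr)
  assume "\<not> p01 * p10 \<le> p00 * p11"
  then have less: "p00 * p11 < p01 * p10"
    by simp
  \<comment> \<open>Both are \<open>less\<close> with a common product added to each side:
    \<open>p10 * p11\<close> in the first, \<open>p00 * p01\<close> in the second.\<close>
  have "p11 * (p00 + p10) < p10 * (p01 + p11)" "p00 * (p01 + p11) < p01 * (p00 + p10)"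
    using less by (simp_all add: algebra_simps)
  then have "p11 / (p01 + p11) < p10 / (p00 + p10)" "p00 / (p00 + p10) < p01 / (p01 + p11)"
    using pos by (simp_all add: divide_less_eq less_divide_eq mult.commute)
  then have "p11 / (p01 + p11) / a1 < p10 / (p00 + p10) / a1"
    "p00 / (p00 + p10) / a0 < p01 / (p01 + p11) / a0"
    using pos by (simp_all only: divide_strict_right_mono)
  then have "p11 / (a1 * (p01 + p11)) < p10 / (a1 * (p00 + p10))"
    "p00 / (a0 * (p00 + p10)) < p01 / (a0 * (p01 + p11))"
    by (simp_all add: mult.commute)
  then have "F (p11 / (a1 * (p01 + p11))) < F (p10 / (a1 * (p00 + p10)))"
    "F (p00 / (a0 * (p00 + p10))) < F (p01 / (a0 * (p01 + p11)))"
    using pos by (auto intro!: strict_mono_onD[OF F])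
  then show False
    using interaction by simp
qed

text \<open>For every logit type the lower set contains the cut point \<open>x\<close> and the upper
  set contains \<open>x + 1\<close>, which is still a category because x < I.\<close>

lemma logit_set_meets_categories:
  assumes "x \<in> {1..<I}"
  shows "\<exists>y\<in>{1..I}. y \<in> logit_set I x u l"
proof -
  have "x \<in> logit_set I x 0 l" "u \<noteq> 0 \<Longrightarrow> x + 1 \<in> logit_set I x u l"
    using assms by (auto simp: logit_set_def)
  then show ?thesis
    using assms by (cases "u = 0") (auto intro: bexI[of _ x] bexI[of _ "x + 1"])
qed

lemma global_logit_set_partition:
  assumes "x \<in> {1..<I}"
  shows "logit_set I x 0 Global \<union> logit_set I x 1 Global = {1..I}"
    and "logit_set I x 0 Global \<inter> logit_set I x 1 Global = {}"
  using assms by (auto simp: logit_set_def)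

lemma measure_pmf_pos_iff: "measure_pmf.prob p A > 0 \<longleftrightarrow> set_pmf p \<inter> A \<noteq> {}"
  using measure_pmf_zero_iff[of p A] by (simp add: zero_less_measure_iff)

text \<open>A marginal event leaves the other coordinate free, so it also contains pairs outside the
  grid. Agreement with the union is therefore asked on the support alone.\<close>

lemma prob_split_on_support:
  assumes "A \<inter> B = {}" and "C \<inter> set_pmf p = (A \<union> B) \<inter> set_pmf p"
  shows "measure_pmf.prob p A + measure_pmf.prob p B = measure_pmf.prob p C"
proof -
  have "measure_pmf.prob p A + measure_pmf.prob p B = measure_pmf.prob p (A \<union> B)"
    using assms(1) by (simp add: measure_pmf.finite_measure_Union)
  also have "\<dots> = measure_pmf.prob p C"
    using assms(2) by (metis measure_Int_set_pmf)
  finally show ?thesis .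
qed

context
  fixes \<pi> :: "(nat \<times> nat) pmf" and I\<^sub>1 I\<^sub>2 i j :: nat
  assumes support: "set_pmf \<pi> = {1..I\<^sub>1} \<times> {1..I\<^sub>2}"
    and i: "i \<in> {1..<I\<^sub>1}" and j: "j \<in> {1..<I\<^sub>2}"
begin

text \<open>Each event contains a cell of the grid, and every cell has positive mass.\<close>

lemma joint_prob_pos: "joint_prob \<pi> I\<^sub>1 I\<^sub>2 l\<^sub>1 l\<^sub>2 i j u v > 0"
  and row_prob_pos: "row_prob \<pi> I\<^sub>1 l\<^sub>1 i u > 0"
  and col_prob_pos: "col_prob \<pi> I\<^sub>2 l\<^sub>2 j v > 0"
proof -
  obtain x y where "x \<in> {1..I\<^sub>1}" "x \<in> logit_set I\<^sub>1 i u l\<^sub>1" "y \<in> {1..I\<^sub>2}" "y \<in> logit_set I\<^sub>2 j v l\<^sub>2"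
    using logit_set_meets_categories[OF i] logit_set_meets_categories[OF j] by meson
  then have "(x, y) \<in> set_pmf \<pi> \<inter>
      {\<omega>. fst \<omega> \<in> logit_set I\<^sub>1 i u l\<^sub>1 \<and> snd \<omega> \<in> logit_set I\<^sub>2 j v l\<^sub>2}"
    by (simp add: support)
  then show "joint_prob \<pi> I\<^sub>1 I\<^sub>2 l\<^sub>1 l\<^sub>2 i j u v > 0" "row_prob \<pi> I\<^sub>1 l\<^sub>1 i u > 0"
    "col_prob \<pi> I\<^sub>2 l\<^sub>2 j v > 0"
    unfolding joint_prob_def row_prob_def col_prob_def measure_pmf_pos_iff by blast+
qed

lemma joint_prob_sum_rows:
  "joint_prob \<pi> I\<^sub>1 I\<^sub>2 Global l\<^sub>2 i j 0 v + joint_prob \<pi> I\<^sub>1 I\<^sub>2 Global l\<^sub>2 i j 1 v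
    = col_prob \<pi> I\<^sub>2 l\<^sub>2 j v"
  unfolding joint_prob_def col_prob_def
  by (rule prob_split_on_support) (use global_logit_set_partition[OF i] support in auto)

lemma joint_prob_sum_cols:
  "joint_prob \<pi> I\<^sub>1 I\<^sub>2 l\<^sub>1 Global i j u 0 + joint_prob \<pi> I\<^sub>1 I\<^sub>2 l\<^sub>1 Global i j u 1
    = row_prob \<pi> I\<^sub>1 l\<^sub>1 i u"
  unfolding joint_prob_def row_prob_def
  by (rule prob_split_on_support) (use global_logit_set_partition[OF j] support in auto)

lemma log_odds_ratio_nonneg_iff:
  "log_odds_ratio \<pi> I\<^sub>1 I\<^sub>2 l\<^sub>1 l\<^sub>2 i j \<ge> 0 \<longleftrightarrow>
    joint_prob \<pi> I\<^sub>1 I\<^sub>2 l\<^sub>1 l\<^sub>2 i j 0 1 * joint_prob \<pi> I\<^sub>1 I\<^sub>2 l\<^sub>1 l\<^sub>2 i j 1 0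
      \<le> joint_prob \<pi> I\<^sub>1 I\<^sub>2 l\<^sub>1 l\<^sub>2 i j 0 0 * joint_prob \<pi> I\<^sub>1 I\<^sub>2 l\<^sub>1 l\<^sub>2 i j 1 1"
proof -
  let ?p = "joint_prob \<pi> I\<^sub>1 I\<^sub>2 l\<^sub>1 l\<^sub>2 i j"
  have pos: "?p u v > 0" for u v
    by (rule joint_prob_pos)
  have "log_odds_ratio \<pi> I\<^sub>1 I\<^sub>2 l\<^sub>1 l\<^sub>2 i j \<ge> 0 \<longleftrightarrow> ln (?p 0 1 * ?p 1 0) \<le> ln (?p 0 0 * ?p 1 1)"
    unfolding log_odds_ratio_def Let_def by (simp only: ln_mult_pos[OF pos pos]) linarith
  also have "\<dots> \<longleftrightarrow> ?p 0 1 * ?p 1 0 \<le> ?p 0 0 * ?p 1 1"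
    by (intro ln_le_cancel_iff mult_pos_pos pos)
  finally show ?thesis .
qed

lemma log_odds_ratio_nonneg:
  assumes F: "strict_mono_on {0<..} F" and l: "l\<^sub>1 = Global \<or> l\<^sub>2 = Global"
    and interaction: "scaled_interaction F \<pi> I\<^sub>1 I\<^sub>2 l\<^sub>1 l\<^sub>2 i j \<ge> 0"
  shows "log_odds_ratio \<pi> I\<^sub>1 I\<^sub>2 l\<^sub>1 l\<^sub>2 i j \<ge> 0"
  using l
proof
  assume l1: "l\<^sub>1 = Global"
  show ?thesis
    unfolding log_odds_ratio_nonneg_iff
    \<comment> \<open>Here \<open>a0\<close> and \<open>a1\<close> are the row marginals;
      \<open>joint_prob_sum_rows\<close> turns the sums into column marginals.\<close>
    by (rule odds_ratio_ge_of_scaled_interaction[OF F joint_prob_pos joint_prob_pos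
          joint_prob_pos joint_prob_pos row_prob_pos[of Global 0] row_prob_pos[of Global 1]])
      (use interaction in \<open>simp only: l1 scaled_interaction_def dependence_ratio_def Let_def
        joint_prob_sum_rows\<close>)
next
  assume l2: "l\<^sub>2 = Global"
  \<comment> \<open>The transposed table: the cells (0,1) and (1,0) exchange roles, hence the order
    of the left-hand factors, and \<open>a0\<close>, \<open>a1\<close> become the column marginals.
    The interaction is unchanged by this exchange.\<close>
  have "joint_prob \<pi> I\<^sub>1 I\<^sub>2 l\<^sub>1 l\<^sub>2 i j 1 0 * joint_prob \<pi> I\<^sub>1 I\<^sub>2 l\<^sub>1 l\<^sub>2 i j 0 1
      \<le> joint_prob \<pi> I\<^sub>1 I\<^sub>2 l\<^sub>1 l\<^sub>2 i j 0 0 * joint_prob \<pi> I\<^sub>1 I\<^sub>2 l\<^sub>1 l\<^sub>2 i j 1 1"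
    by (rule odds_ratio_ge_of_scaled_interaction[OF F joint_prob_pos joint_prob_pos
          joint_prob_pos joint_prob_pos col_prob_pos[of Global 0] col_prob_pos[of Global 1]])
      (use interaction in \<open>simp add: l2 scaled_interaction_def dependence_ratio_def Let_def
        joint_prob_sum_cols[simplified] mult.commute\<close>)
  then show ?thesis
    unfolding log_odds_ratio_nonneg_iff by (simp only: mult.commute)
qed

end

theorem proposition4:
  fixes \<phi> F :: "real \<Rightarrow> real"
    and \<pi> :: "(nat \<times> nat) pmf"
    and I\<^sub>1 I\<^sub>2 :: nat
    and l\<^sub>1 l\<^sub>2 :: logit_type
  assumes "convex_on {0..} \<phi>"
    and "\<forall>x>0. (\<phi> has_real_derivative F x) (at x)"
    and "\<phi> 1 = 0" and "F 1 = 0"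
    and "strict_mono_on {0<..} F"
    and "I\<^sub>1 \<ge> 2" and "I\<^sub>2 \<ge> 2"
    and "set_pmf \<pi> = {1..I\<^sub>1} \<times> {1..I\<^sub>2}"
    and "l\<^sub>1 = Global \<or> l\<^sub>2 = Global"
    and "\<forall>i\<in>{1..<I\<^sub>1}. \<forall>j\<in>{1..<I\<^sub>2}. scaled_interaction F \<pi> I\<^sub>1 I\<^sub>2 l\<^sub>1 l\<^sub>2 i j \<ge> 0"
  shows "\<forall>i\<in>{1..<I\<^sub>1}. \<forall>j\<in>{1..<I\<^sub>2}. log_odds_ratio \<pi> I\<^sub>1 I\<^sub>2 l\<^sub>1 l\<^sub>2 i j \<ge> 0"
  using assms(5,8-10) log_odds_ratio_nonneg by blast

end
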